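(* Let $I\subseteq\mathbb{R}$ be a nonempty open interval, let $d\ge 2$, and let $M,N:I^d\to I$ be $d$-variable means such that $M$ is locally smaller than $N$ at a point $x_0\in I$. Assume that $M$ and $N$ are partially differentiable at the diagonal point $(x_0,\dots,x_0)\in I^d$. Then, for $x=x_0$ and for all $i\in\{1,\dots,d\}$, $$\partial_i M(x,\dots,x)=\partial_i N(x,\dots,x).\qquad(\ast)$$ If, in addition, $M$ and $N$ are twice differentiable at $(x_0,\dots,x_0)$, then the symmetric $(d-1)\times(d-1)$-matrix $$\big(\partial_i\partial_j N(x_0,\dots,x_0)-\partial_i\partial_j M(x_0,\dots,x_0)\big)_{i,j=1}^{d-1}\qquad(\ast\ast)$$ is positive semidefinite. Conversely, let $M,N:I^d\to I$ be $d$-variable means and $x_0\in I$. If the equality $(\ast)$ holds for all $i\in\{1,\dots,d\}$ and for all $x$ in a neighborhood of $x_0$, and furthermore $M$ and $N$ are twice continuously differentiable at $(x_0,\dots,x_0)$ and the symmetric $(d-1)\times(d-1)$-matrix given by $(\ast\ast)$ is positive definite, then $M$ is locally smaller than $N$ at $x_0$.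
   Context: A function $M:I^d\to I$ is a $d$-variable mean on $I$ if $\min(x_1,\dots,x_d)\le M(x_1,\dots,x_d)\le\max(x_1,\dots,x_d)$ for all $(x_1,\dots,x_d)\in I^d$. Given two $d$-variable means $M,N:I^d\to I$, $M$ is called locally smaller than $N$ at $x_0\in I$ if there exists a neighborhood $U\subseteq I$ of $x_0$ such that $M(\pmb{x})\le N(\pmb{x})$ for all $\pmb{x}\in U^d$. $\partial_i$ denotes the partial derivative with respect to the $i$th variable. "Twice continuously differentiable at $(x_0,\dots,x_0)$" means: twice differentiable on $U^d$ for some neighborhood $U\subseteq I$ of $x_0$, with second-order partial derivatives continuous at $(x_0,\dots,x_0)$. *)

theory Defs
  imports "HOL-Analysis.Analysis"
begin

text \<open>The number of variables is the cardinality of the finite index type; the diagonal point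
  with all coordinates equal to \<open>x\<close> is \<^term>\<open>vec x\<close>. A function on the cube over \<open>I\<close> is
  represented by a total function on the whole space, whose values outside the cube are never used.\<close>

definition cube :: "real set \<Rightarrow> (real ^ 'n) set" where
  "cube I = {x. \<forall>i. x $ i \<in> I}"

definition is_mean :: "real set \<Rightarrow> (real ^ 'n \<Rightarrow> real) \<Rightarrow> bool" where
  "is_mean I M \<longleftrightarrow> (\<forall>x \<in> cube I. M x \<in> I \<and>
     Min (range (\<lambda>i. x $ i)) \<le> M x \<and> M x \<le> Max (range (\<lambda>i. x $ i)))"

definition locally_smaller ::
    "real set \<Rightarrow> real \<Rightarrow> (real ^ 'n \<Rightarrow> real) \<Rightarrow> (real ^ 'n \<Rightarrow> real) \<Rightarrow> bool" where
  "locally_smaller I x0 M N \<longleftrightarrow>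
     (\<exists>U. open U \<and> x0 \<in> U \<and> U \<subseteq> I \<and> (\<forall>x \<in> cube U. M x \<le> N x))"

definition partially_differentiable_at :: "(real ^ 'n \<Rightarrow> real) \<Rightarrow> real ^ 'n \<Rightarrow> bool" where
  "partially_differentiable_at f x \<longleftrightarrow>
     (\<forall>i. (\<lambda>t. f (x + t *\<^sub>R axis i 1)) differentiable (at 0))"

definition partial_deriv :: "'n \<Rightarrow> (real ^ 'n \<Rightarrow> real) \<Rightarrow> real ^ 'n \<Rightarrow> real" where
  "partial_deriv i f x = deriv (\<lambda>t. f (x + t *\<^sub>R axis i 1)) 0"

text \<open>Differentiability is understood in the sense of Frechet: the derivative exists in a
  neighbourhood of the point and, as a map into the space of bounded linear functionals, is itself
  differentiable at the point.\<close>

definition twice_differentiable_at :: "(real ^ 'n \<Rightarrow> real) \<Rightarrow> real ^ 'n \<Rightarrow> bool" where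
  "twice_differentiable_at f x \<longleftrightarrow>
     (\<exists>V (f' :: real ^ 'n \<Rightarrow> (real ^ 'n) \<Rightarrow>\<^sub>L real). open V \<and> x \<in> V \<and>
        (\<forall>y \<in> V. (f has_derivative blinfun_apply (f' y)) (at y)) \<and>
        f' differentiable (at x))"

definition twice_cont_differentiable_at_diag ::
    "real set \<Rightarrow> (real ^ 'n \<Rightarrow> real) \<Rightarrow> real \<Rightarrow> bool" where
  "twice_cont_differentiable_at_diag I f x0 \<longleftrightarrow>
     (\<exists>U. open U \<and> x0 \<in> U \<and> U \<subseteq> I \<and> (\<forall>x \<in> cube U. twice_differentiable_at f x)) \<and>
     (\<forall>i j. isCont (partial_deriv i (partial_deriv j f)) (vec x0))"

text \<open>The map \<open>\<iota>\<close> enumerates all variables but one, the omitted variable being the last one.\<close>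

definition second_deriv_diff_matrix ::
    "('m \<Rightarrow> 'n) \<Rightarrow> (real ^ 'n \<Rightarrow> real) \<Rightarrow> (real ^ 'n \<Rightarrow> real) \<Rightarrow> real \<Rightarrow> real ^ 'm ^ 'm" where
  "second_deriv_diff_matrix \<iota> M N x0 =
     (\<chi> i j. partial_deriv (\<iota> i) (partial_deriv (\<iota> j) N) (vec x0) -
            partial_deriv (\<iota> i) (partial_deriv (\<iota> j) M) (vec x0))"

text \<open>The two notions of definiteness below do not include symmetry of the matrix.\<close>

definition positive_semidefinite :: "real ^ 'm ^ 'm \<Rightarrow> bool" where
  "positive_semidefinite A \<longleftrightarrow> (\<forall>v. 0 \<le> v \<bullet> (A *v v))"

definition positive_definite :: "real ^ 'm ^ 'm \<Rightarrow> bool" where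
  "positive_definite A \<longleftrightarrow> (\<forall>v. v \<noteq> 0 \<longrightarrow> 0 < v \<bullet> (A *v v))"

end

theory Submission
  imports Defs
begin

text \<open>Put \<open>F = N - M\<close>, which vanishes on the diagonal because means are reflexive. If \<open>F \<ge> 0\<close> near
  \<open>vec x0\<close>, then \<open>F\<close> has a local minimum there, so its first partial derivatives vanish and its
  second derivative along every line is nonnegative; restricting to directions with vanishing
  omitted coordinate gives semidefiniteness.

  Conversely, let \<open>k\<close> be the omitted index and write \<open>x = p + v\<close> with \<open>p = vec (x $ k)\<close>, so that
  \<open>v $ k = 0\<close>. Along the segment from \<open>p\<close> to \<open>x\<close> the function \<open>F\<close> starts with value and slope \<open>0\<close>,
  and its second derivative is the quadratic form of the reduced Hessian at a point near \<open>vec x0\<close>,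
  which is still nonnegative since positive definiteness is an open condition. Hence \<open>F x \<ge> 0\<close>.\<close>

section \<open>Derivatives along lines and symmetry of the second derivative\<close>

lemma has_real_derivative_along_line:
  fixes f :: "'a::real_normed_vector \<Rightarrow> real"
  assumes "(f has_derivative f') (at (p + t *\<^sub>R v))"
  shows "((\<lambda>s. f (p + s *\<^sub>R v)) has_real_derivative f' v) (at t)"
proof -
  have "((\<lambda>s. p + s *\<^sub>R v) has_derivative (\<lambda>s. s *\<^sub>R v)) (at t)"
    by (auto intro!: derivative_eq_intros)
  from has_derivative_compose[OF this assms] show ?thesis
    using linear_scale[OF has_derivative_linear[OF assms]]
    by (simp add: has_field_derivative_def mult_commute_abs)
qed

text \<open>Swapping \<open>u\<close> and \<open>v\<close> leaves the quotient unchanged, so the limit yields symmetry of the second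
  derivative without assuming it continuous.\<close>

lemma second_difference_tendsto:
  fixes f :: "'a::real_normed_vector \<Rightarrow> real" and f' :: "'a \<Rightarrow> 'a \<Rightarrow>\<^sub>L real"
  assumes f: "\<forall>\<^sub>F y in nhds x. (f has_derivative blinfun_apply (f' y)) (at y)"
    and f': "(f' has_derivative H) (at x)"
  shows "((\<lambda>s. (f (x + s *\<^sub>R u + s *\<^sub>R v) - f (x + s *\<^sub>R u) - f (x + s *\<^sub>R v) + f x) / s\<^sup>2)
           \<longlongrightarrow> blinfun_apply (H u) v) (at_right 0)"
proof (rule tendstoI)
  fix \<epsilon> :: real assume \<epsilon>: "\<epsilon> > 0"
  \<comment> \<open>The two summands come from linearizing \<open>f'\<close> on the two sides of the
    parallelogram in direction \<open>v\<close>: the side shifted by \<open>s *\<^sub>R u\<close>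
    and the unshifted one. The \<open>+ 1\<close> in the denominator of \<open>e\<close> covers
    \<open>K = 0\<close>.\<close>
  define K where "K = (norm u + norm v) * norm v + norm v * norm v"
  have K: "K \<ge> 0" by (simp add: K_def)
  define e where "e = \<epsilon> / (K + 1)"
  have e: "e > 0" "e * K < \<epsilon>"
    using \<epsilon> K by (simp_all add: e_def field_simps)
  obtain r where r: "r > 0" "\<And>y. dist y x < r \<Longrightarrow> (f has_derivative blinfun_apply (f' y)) (at y)"
    using f by (auto simp: eventually_nhds_metric)
  obtain d where d: "d > 0"
      "\<And>y. norm (y - x) < d \<Longrightarrow> norm (f' y - f' x - H (y - x)) \<le> e * norm (y - x)"
    using f' e(1) unfolding has_derivative_at_alt by blast
  interpret H: bounded_linear H using f' by (rule has_derivative_bounded_linear)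
  \<comment> \<open>For \<open>s < \<delta>\<close> the whole parallelogram spanned at
    \<open>x\<close> by \<open>s *\<^sub>R u\<close> and \<open>s *\<^sub>R v\<close> stays where
    \<open>f\<close> is differentiable and the linearization of \<open>f'\<close> is accurate. The
    \<open>+ 1\<close> covers \<open>u = v = 0\<close>.\<close>
  define \<delta> where "\<delta> = min r d / (norm u + norm v + 1)"
  have nuv: "norm u + norm v + 1 > 0" by (simp add: add_nonneg_pos)
  have \<delta>: "\<delta> > 0" using r d nuv by (simp add: \<delta>_def)
  show "\<forall>\<^sub>F s in at_right 0. dist ((f (x + s *\<^sub>R u + s *\<^sub>R v) - f (x + s *\<^sub>R u) - f (x + s *\<^sub>R v) + f x) / s\<^sup>2)
          (blinfun_apply (H u) v) < \<epsilon>"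
    unfolding eventually_at_right_field
  proof (intro exI[of _ \<delta>] conjI allI impI \<delta>)
    fix s :: real assume s: "0 < s" "s < \<delta>"
    have bound: "norm (s *\<^sub>R (a *\<^sub>R u + t *\<^sub>R v)) \<le> s * (a * norm u + norm v)"
      if "0 \<le> t" "t \<le> 1" "0 \<le> a" for t a
    proof -
      have "norm (a *\<^sub>R u + t *\<^sub>R v) \<le> a * norm u + t * norm v"
        using norm_triangle_ineq[of "a *\<^sub>R u" "t *\<^sub>R v"] that by simp
      also have "\<dots> \<le> a * norm u + norm v" using that by (simp add: mult_left_le_one_le)
      finally show ?thesis using s by simp
    qed
    have small: "norm (s *\<^sub>R (a *\<^sub>R u + t *\<^sub>R v)) < min r d"
      if "0 \<le> t" "t \<le> 1" "0 \<le> a" "a \<le> 1" for t a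
    proof -
      have "norm (s *\<^sub>R (a *\<^sub>R u + t *\<^sub>R v)) \<le> s * (a * norm u + norm v)"
        using bound that by blast
      also have "\<dots> \<le> s * (norm u + norm v + 1)"
        using s that by (intro mult_left_mono) (auto simp: mult_left_le_one_le add_increasing2)
      also have "\<dots> < \<delta> * (norm u + norm v + 1)"
        using s nuv by (intro mult_strict_right_mono) auto
      also have "\<dots> = min r d" using nuv by (simp add: \<delta>_def)
      finally show ?thesis .
    qed
    \<comment> \<open>The parallelogram is parametrized by \<open>a\<close> in direction
      \<open>u\<close> and \<open>t\<close> in direction \<open>v\<close>, so the second difference
      is the increment over [0, 1] of \<open>f (p 1 t) - f (p 0 t)\<close>.\<close>
    define p where "p a t = x + s *\<^sub>R (a *\<^sub>R u + t *\<^sub>R v)" for a t :: real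
    have p: "p a t - x = s *\<^sub>R (a *\<^sub>R u + t *\<^sub>R v)" for a t by (simp add: p_def)
    have der: "((\<lambda>t. f (p a t)) has_real_derivative s * blinfun_apply (f' (p a t)) v) (at t)"
      if "0 \<le> t" "t \<le> 1" "0 \<le> a" "a \<le> 1" for a t
    proof -
      have *: "(f has_derivative blinfun_apply (f' (p a t))) (at (p a t))"
        using r(2)[of "p a t"] small[OF that] by (simp add: dist_norm p)
      have "p a \<tau> = (x + (s * a) *\<^sub>R u) + \<tau> *\<^sub>R (s *\<^sub>R v)" for \<tau>
        by (simp add: p_def algebra_simps)
      then show ?thesis
        using has_real_derivative_along_line[of f "blinfun_apply (f' (p a t))" "x + (s * a) *\<^sub>R u" t "s *\<^sub>R v"] *
        by (simp add: blinfun.scaleR_right)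
    qed
    \<comment> \<open>Differentiability of \<open>f'\<close> at \<open>x\<close> alone gives an
      expansion about \<open>x\<close>, so points on both sides are compared with \<open>x\<close>
      rather than with each other.\<close>
    have lin: "\<bar>blinfun_apply (f' (p a t)) v - blinfun_apply (f' x) v - blinfun_apply (H (p a t - x)) v\<bar>
        \<le> e * (s * (a * norm u + norm v)) * norm v"
      if "0 \<le> t" "t \<le> 1" "0 \<le> a" "a \<le> 1" for a t
    proof -
      have "\<bar>blinfun_apply (f' (p a t) - f' x - H (p a t - x)) v\<bar>
          \<le> norm (f' (p a t) - f' x - H (p a t - x)) * norm v"
        using norm_blinfun[of "f' (p a t) - f' x - H (p a t - x)" v] by simp
      also have "\<dots> \<le> (e * norm (p a t - x)) * norm v"
        using d(2)[of "p a t"] small[OF that] by (intro mult_right_mono) (auto simp: p)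
      also have "\<dots> \<le> e * (s * (a * norm u + norm v)) * norm v"
        using bound[of t a] that e(1) by (intro mult_right_mono mult_left_mono) (auto simp: p)
      finally show ?thesis by (simp add: blinfun.diff_left)
    qed
    \<comment> \<open>Applying the mean value theorem to the difference of the two sides yields one
      common \<open>\<xi>\<close> for both.\<close>
    obtain \<xi> where \<xi>: "0 < \<xi>" "\<xi> < 1"
      and mvt: "(f (p 1 1) - f (p 0 1)) - (f (p 1 0) - f (p 0 0)) =
        s * (blinfun_apply (f' (p 1 \<xi>)) v - blinfun_apply (f' (p 0 \<xi>)) v)"
    proof -
      have "\<exists>z. 0 < z \<and> z < 1 \<and> (f (p 1 1) - f (p 0 1)) - (f (p 1 0) - f (p 0 0)) =
        (1 - 0) * (s * blinfun_apply (f' (p 1 z)) v - s * blinfun_apply (f' (p 0 z)) v)"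
        by (rule MVT2) (auto intro!: DERIV_diff der)
      then show ?thesis using that by (auto simp: algebra_simps)
    qed
    \<comment> \<open>Because \<open>\<xi>\<close> is common, the components along \<open>v\<close>
      cancel and only the displacement \<open>s *\<^sub>R u\<close> remains.\<close>
    have Hd: "blinfun_apply (H (p 1 \<xi> - x)) v - blinfun_apply (H (p 0 \<xi> - x)) v = s * blinfun_apply (H u) v"
      by (simp add: p H.scaleR H.add blinfun.scaleR_left blinfun.add_left algebra_simps)
    have "\<bar>blinfun_apply (f' (p 1 \<xi>)) v - blinfun_apply (f' (p 0 \<xi>)) v - s * blinfun_apply (H u) v\<bar>
        \<le> e * (s * (1 * norm u + norm v)) * norm v + e * (s * (0 * norm u + norm v)) * norm v"
      using lin[of \<xi> 1] lin[of \<xi> 0] \<xi> Hd by linarith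
    also have "\<dots> = s * (e * K)" by (simp add: K_def algebra_simps)
    also have "\<dots> < s * \<epsilon>" using e s by simp
    finally have "\<bar>s * (blinfun_apply (f' (p 1 \<xi>)) v - blinfun_apply (f' (p 0 \<xi>)) v - s * blinfun_apply (H u) v)\<bar> < s * (s * \<epsilon>)"
      using s by (simp add: abs_mult)
    then have "\<bar>(f (p 1 1) - f (p 0 1)) - (f (p 1 0) - f (p 0 0)) - s\<^sup>2 * blinfun_apply (H u) v\<bar> < s\<^sup>2 * \<epsilon>"
      unfolding mvt by (simp add: algebra_simps power2_eq_square)
    moreover have "(f (p 1 1) - f (p 0 1)) - (f (p 1 0) - f (p 0 0)) =
        f (x + s *\<^sub>R u + s *\<^sub>R v) - f (x + s *\<^sub>R u) - f (x + s *\<^sub>R v) + f x"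
      by (simp add: p_def algebra_simps)
    ultimately have A: "\<bar>f (x + s *\<^sub>R u + s *\<^sub>R v) - f (x + s *\<^sub>R u) - f (x + s *\<^sub>R v) + f x
        - s\<^sup>2 * blinfun_apply (H u) v\<bar> < s\<^sup>2 * \<epsilon>" by simp
    have eq: "D / s\<^sup>2 - h = (D - s\<^sup>2 * h) / s\<^sup>2" for D h :: real
      using s by (simp add: field_simps)
    show "dist ((f (x + s *\<^sub>R u + s *\<^sub>R v) - f (x + s *\<^sub>R u) - f (x + s *\<^sub>R v) + f x) / s\<^sup>2)
          (blinfun_apply (H u) v) < \<epsilon>"
      unfolding dist_real_def eq abs_divide using A s by (simp add: field_simps)
  qed
qed

lemma symmetric_second_derivative:
  fixes f :: "'a::real_normed_vector \<Rightarrow> real" and f' :: "'a \<Rightarrow> 'a \<Rightarrow>\<^sub>L real"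
  assumes "\<forall>\<^sub>F y in nhds x. (f has_derivative blinfun_apply (f' y)) (at y)"
    and "(f' has_derivative H) (at x)"
  shows "blinfun_apply (H u) v = blinfun_apply (H v) u"
proof (rule tendsto_unique[OF trivial_limit_at_right_real second_difference_tendsto[OF assms]])
  have "(\<lambda>s. (f (x + s *\<^sub>R u + s *\<^sub>R v) - f (x + s *\<^sub>R u) - f (x + s *\<^sub>R v) + f x) / s\<^sup>2) =
     (\<lambda>s. (f (x + s *\<^sub>R v + s *\<^sub>R u) - f (x + s *\<^sub>R v) - f (x + s *\<^sub>R u) + f x) / s\<^sup>2)"
    by (simp add: algebra_simps)
  then show "((\<lambda>s. (f (x + s *\<^sub>R u + s *\<^sub>R v) - f (x + s *\<^sub>R u) - f (x + s *\<^sub>R v) + f x) / s\<^sup>2)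
           \<longlongrightarrow> blinfun_apply (H v) u) (at_right 0)"
    using second_difference_tendsto[OF assms, of v u] by (simp only:)
qed

section \<open>Partial and directional derivatives of twice differentiable functions\<close>

lemma partial_deriv_eqI:
  assumes "(f has_derivative f') (at x)"
  shows "partial_deriv i f x = f' (axis i 1)"
  unfolding partial_deriv_def
  using assms by (intro DERIV_imp_deriv has_real_derivative_along_line) simp

lemma linear_axis_expansion:
  fixes g :: "real ^ 'n \<Rightarrow> 'b::real_vector"
  assumes "linear g"
  shows "g h = (\<Sum>i\<in>UNIV. h $ i *\<^sub>R g (axis i 1))"
proof -
  have "g h = g (\<Sum>i\<in>UNIV. h $ i *\<^sub>R axis i 1)"
    using basis_expansion[of h] by (simp add: scalar_mult_eq_scaleR)
  then show ?thesis using assms by (simp add: linear_sum linear_scale)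
qed

text \<open>Passes from the functional-valued derivative to partial derivatives: the mixed partials
  are the values of the bilinear second derivative at pairs of axis vectors, so their symmetry is
  that of the second derivative.\<close>

lemma twice_differentiable_partials:
  fixes f :: "real ^ 'n \<Rightarrow> real"
  assumes "twice_differentiable_at f x"
  shows "\<forall>\<^sub>F y in nhds x. (f has_derivative (\<lambda>h. \<Sum>j\<in>UNIV. h $ j * partial_deriv j f y)) (at y)"
    and "(partial_deriv j f has_derivative
           (\<lambda>h. \<Sum>i\<in>UNIV. h $ i * partial_deriv i (partial_deriv j f) x)) (at x)"
    and "partial_deriv i (partial_deriv j f) x = partial_deriv j (partial_deriv i f) x"
proof -
  obtain V and f' :: "real ^ 'n \<Rightarrow> (real ^ 'n) \<Rightarrow>\<^sub>L real" and H
    where V: "open V" "x \<in> V" "\<And>y. y \<in> V \<Longrightarrow> (f has_derivative blinfun_apply (f' y)) (at y)"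
      and H: "(f' has_derivative H) (at x)"
    using assms unfolding twice_differentiable_at_def differentiable_def by blast
  have ev: "\<forall>\<^sub>F y in nhds x. y \<in> V" using V by (simp add: eventually_nhds_in_open)
  then have ev': "\<forall>\<^sub>F y in nhds x. (f has_derivative blinfun_apply (f' y)) (at y)"
    by eventually_elim (rule V)
  have pd: "partial_deriv j f y = blinfun_apply (f' y) (axis j 1)" if "y \<in> V" for j y
    using V(3)[OF that] by (rule partial_deriv_eqI)
  have "(f has_derivative (\<lambda>h. \<Sum>j\<in>UNIV. h $ j * partial_deriv j f y)) (at y)" if "y \<in> V" for y
  proof -
    have "blinfun_apply (f' y) = (\<lambda>h. \<Sum>j\<in>UNIV. h $ j * partial_deriv j f y)"
      using linear_axis_expansion[OF has_derivative_linear[OF V(3)[OF that]]]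
      unfolding pd[OF that] real_scaleR_def by (rule ext)
    then show ?thesis using V(3)[OF that] by simp
  qed
  then show "\<forall>\<^sub>F y in nhds x. (f has_derivative (\<lambda>h. \<Sum>j\<in>UNIV. h $ j * partial_deriv j f y)) (at y)"
    using ev by (auto elim: eventually_mono)
  \<comment> \<open>Evaluation at \<open>axis j 1\<close> is bounded linear and hence commutes with
    differentiation. The partial derivative is known to equal the evaluated \<open>f'\<close> on
    \<open>V\<close>, which suffices since \<open>V\<close> is open.\<close>
  have pd_der: "(partial_deriv j f has_derivative (\<lambda>h. blinfun_apply (H h) (axis j 1))) (at x)" for j
  proof -
    have "((\<lambda>y. blinfun_apply (f' y) (axis j 1)) has_derivative (\<lambda>h. blinfun_apply (H h) (axis j 1))) (at x)"
      by (rule bounded_linear.has_derivative[OF blinfun.bounded_linear_left H])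
    then show ?thesis
      by (rule has_derivative_transform_within_open[OF _ V(1,2)]) (simp add: pd)
  qed
  have pd2: "partial_deriv i (partial_deriv j f) x = blinfun_apply (H (axis i 1)) (axis j 1)" for i j
    by (rule partial_deriv_eqI[OF pd_der])
  show "partial_deriv i (partial_deriv j f) x = partial_deriv j (partial_deriv i f) x"
    unfolding pd2 by (rule symmetric_second_derivative[OF ev' H])
  have "(\<lambda>h. blinfun_apply (H h) (axis j 1)) =
      (\<lambda>h. \<Sum>i\<in>UNIV. h $ i * partial_deriv i (partial_deriv j f) x)"
    unfolding pd2 real_scaleR_def[symmetric]
    by (rule ext) (rule linear_axis_expansion[OF has_derivative_linear[OF pd_der]])
  with pd_der[of j] show "(partial_deriv j f has_derivative
           (\<lambda>h. \<Sum>i\<in>UNIV. h $ i * partial_deriv i (partial_deriv j f) x)) (at x)"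
    by (simp only:)
qed

text \<open>Written through partial derivatives, so that the first-order equality and the entries of
  the matrix can be substituted directly; likewise for \<open>dir_deriv2\<close>.\<close>

definition dir_deriv :: "(real ^ 'n \<Rightarrow> real) \<Rightarrow> real ^ 'n \<Rightarrow> real ^ 'n \<Rightarrow> real" where
  "dir_deriv f v y = (\<Sum>j\<in>UNIV. v $ j * partial_deriv j f y)"

definition dir_deriv2 :: "(real ^ 'n \<Rightarrow> real) \<Rightarrow> real ^ 'n \<Rightarrow> real ^ 'n \<Rightarrow> real" where
  "dir_deriv2 f v y = (\<Sum>j\<in>UNIV. v $ j * (\<Sum>i\<in>UNIV. v $ i * partial_deriv i (partial_deriv j f) y))"

lemma twice_differentiable_along_line:
  assumes "twice_differentiable_at f (p + t *\<^sub>R v)"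
  shows "\<forall>\<^sub>F s in nhds t. ((\<lambda>s. f (p + s *\<^sub>R v)) has_real_derivative dir_deriv f v (p + s *\<^sub>R v)) (at s)"
    and "((\<lambda>s. f (p + s *\<^sub>R v)) has_real_derivative dir_deriv f v (p + t *\<^sub>R v)) (at t)"
    and "((\<lambda>s. dir_deriv f v (p + s *\<^sub>R v)) has_real_derivative dir_deriv2 f v (p + t *\<^sub>R v)) (at t)"
proof -
  have "filterlim (\<lambda>s. p + s *\<^sub>R v) (nhds (p + t *\<^sub>R v)) (nhds t)"
    by (intro tendsto_intros filterlim_ident)
  from eventually_compose_filterlim[OF twice_differentiable_partials(1)[OF assms] this]
  show *: "\<forall>\<^sub>F s in nhds t. ((\<lambda>s. f (p + s *\<^sub>R v)) has_real_derivative dir_deriv f v (p + s *\<^sub>R v)) (at s)"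
    unfolding dir_deriv_def by eventually_elim (rule has_real_derivative_along_line)
  then show "((\<lambda>s. f (p + s *\<^sub>R v)) has_real_derivative dir_deriv f v (p + t *\<^sub>R v)) (at t)"
    by (rule eventually_nhds_x_imp_x)
  show "((\<lambda>s. dir_deriv f v (p + s *\<^sub>R v)) has_real_derivative dir_deriv2 f v (p + t *\<^sub>R v)) (at t)"
    unfolding dir_deriv_def dir_deriv2_def
    by (intro DERIV_sum DERIV_cmult
        has_real_derivative_along_line[OF twice_differentiable_partials(2)[OF assms]])
qed

section \<open>Second-order criteria in one variable\<close>

text \<open>If \<open>D\<close> were negative, \<open>g'\<close> would be negative just to the right
  of 0, and by the mean value theorem \<open>g\<close> would drop below \<open>g 0\<close>
  there.\<close>

lemma second_derivative_nonneg_at_local_min: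
  fixes g g' :: "real \<Rightarrow> real"
  assumes g: "\<forall>\<^sub>F s in nhds 0. (g has_real_derivative g' s) (at s)"
    and g': "(g' has_real_derivative D) (at 0)"
    and zero: "g' 0 = 0"
    and min: "\<forall>\<^sub>F s in nhds 0. g 0 \<le> g s"
  shows "D \<ge> 0"
proof (rule ccontr)
  assume "\<not> D \<ge> 0"
  then obtain d where d: "d > 0" "\<And>h. 0 < h \<Longrightarrow> h < d \<Longrightarrow> g' h < 0"
    using DERIV_neg_dec_right[OF g'] zero by auto
  obtain r where r: "r > 0" "\<And>s. \<bar>s\<bar> < r \<Longrightarrow> (g has_real_derivative g' s) (at s) \<and> g 0 \<le> g s"
    using eventually_conj[OF g min] by (auto simp: eventually_nhds_metric dist_real_def)
  define h where "h = min d r / 2"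
  have h: "0 < h" "h < d" "h < r" using d r by (auto simp: h_def)
  obtain z where "0 < z" "z < h" "g h - g 0 = (h - 0) * g' z"
    using MVT2[of 0 h g g'] h r by auto
  moreover have "h * g' z < 0" using d calculation h by (simp add: mult_pos_neg)
  ultimately show False using r(2)[of h] h by simp
qed

text \<open>Monotonicity twice: \<open>g'\<close> increases from 0, hence is nonnegative, hence
  \<open>g\<close> increases from 0.\<close>

lemma nonneg_by_second_derivative:
  fixes g g' g'' :: "real \<Rightarrow> real"
  assumes g: "\<And>t. 0 \<le> t \<Longrightarrow> t \<le> 1 \<Longrightarrow> (g has_real_derivative g' t) (at t)"
    and g': "\<And>t. 0 \<le> t \<Longrightarrow> t \<le> 1 \<Longrightarrow> (g' has_real_derivative g'' t) (at t)"
    and "\<And>t. 0 \<le> t \<Longrightarrow> t \<le> 1 \<Longrightarrow> 0 \<le> g'' t"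
    and "g 0 = 0" "g' 0 = 0"
  shows "0 \<le> g 1"
proof -
  have "0 \<le> g' t" if "0 \<le> t" "t \<le> 1" for t
    using DERIV_nonneg_imp_nondecreasing[of 0 t g'] assms that by (metis order_trans)
  then show ?thesis
    using DERIV_nonneg_imp_nondecreasing[of 0 1 g] g \<open>g 0 = 0\<close> by (metis zero_le_one)
qed

section \<open>Definite matrices and the reduced quadratic form\<close>

text \<open>By compactness the form of \<open>A\<close> has a minimum \<open>c > 0\<close> on the
  unit sphere. The sum of the absolute entries of \<open>B - A\<close> bounds its operator norm, so
  once this sum is below \<open>c\<close> the form of \<open>B\<close> is positive on the
  sphere.\<close>

lemma positive_definite_nhds:
  fixes A :: "real ^ 'm ^ 'm"
  assumes "positive_definite A"
  shows "\<forall>\<^sub>F B in nhds A. positive_semidefinite B"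
proof -
  have "continuous_on (sphere (0::real^'m) 1) (\<lambda>v. v \<bullet> (A *v v))"
    by (intro continuous_intros linear_continuous_on_compose[of _ id, simplified])
       (auto simp: matrix_vector_mul_linear)
  moreover have "sphere (0::real^'m) 1 \<noteq> {}" by simp
  ultimately obtain v0 where v0: "norm v0 = 1"
      "\<And>v. norm v = 1 \<Longrightarrow> v0 \<bullet> (A *v v0) \<le> v \<bullet> (A *v v)"
    using continuous_attains_inf[OF compact_sphere, of 0 1 "\<lambda>v. v \<bullet> (A *v v)"] by auto
  define c where "c = v0 \<bullet> (A *v v0)"
  have c: "c > 0" using assms v0(1) unfolding c_def positive_definite_def by (metis norm_zero zero_neq_one)
  have "((\<lambda>B. \<Sum>i\<in>UNIV. \<Sum>j\<in>UNIV. \<bar>(B - A) $ i $ j\<bar>) \<longlongrightarrow> (\<Sum>i\<in>UNIV. \<Sum>j\<in>UNIV. \<bar>(A - A) $ i $ j\<bar>)) (nhds A)"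
    by (intro tendsto_intros filterlim_ident)
  then have "\<forall>\<^sub>F B in nhds A. (\<Sum>i\<in>UNIV. \<Sum>j\<in>UNIV. \<bar>(B - A) $ i $ j\<bar>) < c"
    by (rule order_tendstoD) (simp add: c)
  then show ?thesis
  proof eventually_elim
    case (elim B)
    have sphere: "0 \<le> v \<bullet> (B *v v)" if v: "norm v = 1" for v
    proof -
      have "\<bar>v \<bullet> ((B - A) *v v)\<bar> \<le> norm v * norm ((B - A) *v v)" by (rule Cauchy_Schwarz_ineq2)
      also have "\<dots> \<le> norm v * (onorm ((*v) (B - A)) * norm v)"
        by (intro mult_left_mono onorm) (auto simp: matrix_vector_mul_bounded_linear)
      also have "\<dots> \<le> (\<Sum>i\<in>UNIV. \<Sum>j\<in>UNIV. \<bar>(B - A) $ i $ j\<bar>)"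
        using onorm_le_matrix_component_sum[of "B - A"] v by simp
      finally have "\<bar>v \<bullet> (B *v v) - v \<bullet> (A *v v)\<bar> < c"
        using elim by (simp add: matrix_vector_mult_diff_rdistrib inner_diff_right)
      then show ?thesis using v0(2)[OF v] by (simp add: c_def)
    qed
    have "0 \<le> v \<bullet> (B *v v)" for v
    proof (cases "v = 0")
      case False
      \<comment> \<open>Homogeneity of degree 2 carries the sign from the sphere to every nonzero
        vector.\<close>
      have "0 \<le> (v /\<^sub>R norm v) \<bullet> (B *v (v /\<^sub>R norm v))" using False by (intro sphere) simp
      then show ?thesis using False
        by (simp add: matrix_vector_mult_scaleR zero_le_mult_iff zero_le_divide_iff)
    qed simp
    then show ?case by (simp add: positive_semidefinite_def)
  qed
qed

text \<open>Coordinates outside \<open>range \<iota>\<close> contribute nothing, and the others are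
  reindexed by \<open>\<iota>\<close>. Exchanging the sums puts the outer differentiation on the row
  index, as in the matrix.\<close>

lemma dir_deriv2_diff_eq_quadratic_form:
  fixes \<iota> :: "'m::finite \<Rightarrow> 'n::finite" and v :: "real ^ 'n"
  assumes "inj \<iota>" and v: "\<And>i. i \<notin> range \<iota> \<Longrightarrow> v $ i = 0"
  shows "dir_deriv2 N v y - dir_deriv2 M v y =
    (\<chi> i. v $ \<iota> i) \<bullet> ((\<chi> i j. partial_deriv (\<iota> i) (partial_deriv (\<iota> j) N) y -
            partial_deriv (\<iota> i) (partial_deriv (\<iota> j) M) y) *v (\<chi> i. v $ \<iota> i))"
proof -
  have sum: "(\<Sum>i\<in>UNIV. v $ i * a i) = (\<Sum>i\<in>UNIV. v $ \<iota> i * a (\<iota> i))" for a :: "'n \<Rightarrow> real"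
  proof -
    have "(\<Sum>i\<in>UNIV. v $ i * a i) = (\<Sum>i\<in>range \<iota>. v $ i * a i)"
      by (rule sum.mono_neutral_right) (auto simp: v)
    then show ?thesis using \<open>inj \<iota>\<close> by (simp add: sum.reindex)
  qed
  have "dir_deriv2 N v y - dir_deriv2 M v y =
      (\<Sum>j\<in>UNIV. \<Sum>i\<in>UNIV. v $ \<iota> j * (v $ \<iota> i * (partial_deriv (\<iota> i) (partial_deriv (\<iota> j) N) y -
            partial_deriv (\<iota> i) (partial_deriv (\<iota> j) M) y)))"
    unfolding dir_deriv2_def sum by (simp add: sum_subtractf[symmetric] sum_distrib_left algebra_simps)
  also have "\<dots> = (\<Sum>i\<in>UNIV. \<Sum>j\<in>UNIV. v $ \<iota> j * (v $ \<iota> i * (partial_deriv (\<iota> i) (partial_deriv (\<iota> j) N) y -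
            partial_deriv (\<iota> i) (partial_deriv (\<iota> j) M) y)))"
    by (rule sum.swap)
  finally show ?thesis
    by (simp add: inner_vec_def matrix_vector_mult_def sum_distrib_left mult_ac)
qed

section \<open>Means on the diagonal and local minima along lines\<close>

lemma cube_vec [simp]: "vec x \<in> cube I \<longleftrightarrow> x \<in> I"
  by (simp add: cube_def)

lemma is_mean_vec:
  fixes M :: "real ^ 'n \<Rightarrow> real"
  assumes "is_mean I M" "x \<in> I"
  shows "M (vec x) = x"
proof -
  have *: "range (\<lambda>i. (vec x :: real ^ 'n) $ i) = {x}" by auto
  have "vec x \<in> (cube I :: (real ^ 'n) set)" using assms(2) by simp
  then have "Min (range (\<lambda>i. (vec x :: real ^ 'n) $ i)) \<le> M (vec x)"
      "M (vec x) \<le> Max (range (\<lambda>i. (vec x :: real ^ 'n) $ i))"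
    using assms(1) unfolding is_mean_def by blast+
  then show ?thesis unfolding * by simp
qed

lemma open_cube:
  assumes "open U"
  shows "open (cube U :: (real ^ 'n) set)"
proof -
  have "cube U = (\<Inter>i. (\<lambda>x :: real ^ 'n. x $ i) -` U)" by (auto simp: cube_def)
  then show ?thesis using assms by (auto intro!: open_INT open_vimage continuous_intros)
qed

text \<open>The means agree at \<open>vec x0\<close>, so the difference has a local minimum there.
  The term \<open>0 *\<^sub>R v\<close> is kept so that the claim reads \<open>g 0 \<le> g s\<close>
  for the restriction \<open>g\<close> to the line.\<close>

lemma locally_smaller_along_line:
  fixes M N :: "real ^ 'n \<Rightarrow> real"
  assumes "is_mean I M" "is_mean I N" "locally_smaller I x0 M N"
  shows "\<forall>\<^sub>F s in nhds 0. N (vec x0 + 0 *\<^sub>R v) - M (vec x0 + 0 *\<^sub>R v)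
           \<le> N (vec x0 + s *\<^sub>R v) - M (vec x0 + s *\<^sub>R v)"
proof -
  obtain U where U: "open U" "x0 \<in> U" "U \<subseteq> I" "\<And>x. x \<in> cube U \<Longrightarrow> M x \<le> N x"
    using assms(3) by (auto simp: locally_smaller_def)
  have "((\<lambda>s. vec x0 + s *\<^sub>R v) \<longlongrightarrow> vec x0 + 0 *\<^sub>R v) (nhds 0)"
    by (intro tendsto_intros filterlim_ident)
  then have "\<forall>\<^sub>F s in nhds 0. vec x0 + s *\<^sub>R v \<in> cube U"
    using U by (intro topological_tendstoD) (auto simp: open_cube)
  moreover have "M (vec x0) = N (vec x0)"
    using assms U by (auto simp: is_mean_vec)
  ultimately show ?thesis by (auto elim!: eventually_mono dest: U(4))
qed

section \<open>Necessary conditions for local comparison\<close>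

text \<open>Fermat's rule on each coordinate line through \<open>vec x0\<close>.\<close>

lemma locally_smaller_imp_partial_deriv_eq:
  fixes M N :: "real ^ 'n \<Rightarrow> real"
  assumes "is_mean I M" "is_mean I N" "locally_smaller I x0 M N"
    and "partially_differentiable_at M (vec x0)" "partially_differentiable_at N (vec x0)"
  shows "partial_deriv i M (vec x0) = partial_deriv i N (vec x0)"
proof -
  define g where "g t = N (vec x0 + t *\<^sub>R axis i 1) - M (vec x0 + t *\<^sub>R axis i 1)" for t
  have "(g has_real_derivative partial_deriv i N (vec x0) - partial_deriv i M (vec x0)) (at 0)"
    using assms(4,5) unfolding g_def partial_deriv_def partially_differentiable_at_def
    by (intro DERIV_diff) (auto simp: DERIV_deriv_iff_real_differentiable)
  moreover obtain d where "d > 0" "\<forall>s. \<bar>0 - s\<bar> < d \<longrightarrow> g 0 \<le> g s"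
    using locally_smaller_along_line[OF assms(1-3), of "axis i 1"]
    by (auto simp: eventually_nhds_metric dist_real_def g_def)
  ultimately have "partial_deriv i N (vec x0) - partial_deriv i M (vec x0) = 0"
    by (rule DERIV_local_min)
  then show ?thesis by simp
qed

lemma second_deriv_diff_matrix_symmetric:
  assumes "twice_differentiable_at M (vec x0)" "twice_differentiable_at N (vec x0)"
  shows "transpose (second_deriv_diff_matrix \<iota> M N x0) = second_deriv_diff_matrix \<iota> M N x0"
  unfolding second_deriv_diff_matrix_def transpose_def
  by (simp add: vec_eq_iff twice_differentiable_partials(3)[OF assms(1)]
      twice_differentiable_partials(3)[OF assms(2)])

lemma locally_smaller_imp_positive_semidefinite:
  fixes M N :: "real ^ 'n \<Rightarrow> real" and \<iota> :: "'m::finite \<Rightarrow> 'n::finite"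
  assumes smaller: "is_mean I M" "is_mean I N" "locally_smaller I x0 M N"
    and "inj \<iota>"
    and M: "twice_differentiable_at M (vec x0)" and N: "twice_differentiable_at N (vec x0)"
    and eq: "\<And>i. partial_deriv i M (vec x0) = partial_deriv i N (vec x0)"
  shows "positive_semidefinite (second_deriv_diff_matrix \<iota> M N x0)"
  unfolding positive_semidefinite_def
proof
  fix w :: "real ^ 'm"
  \<comment> \<open>The direction is \<open>w\<close> padded with zeros outside
    \<open>range \<iota>\<close>, so reading \<open>v\<close> along \<open>\<iota>\<close> recovers
    \<open>w\<close>.\<close>
  define v :: "real ^ 'n" where "v = (\<chi> i. if i \<in> range \<iota> then w $ inv \<iota> i else 0)"
  have w: "(\<chi> i. v $ \<iota> i) = w" using \<open>inj \<iota>\<close> by (simp add: v_def vec_eq_iff)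
  define g g' where "g = (\<lambda>s. N (vec x0 + s *\<^sub>R v) - M (vec x0 + s *\<^sub>R v))"
    and "g' = (\<lambda>s. dir_deriv N v (vec x0 + s *\<^sub>R v) - dir_deriv M v (vec x0 + s *\<^sub>R v))"
  have M0: "twice_differentiable_at M (vec x0 + 0 *\<^sub>R v)"
    and N0: "twice_differentiable_at N (vec x0 + 0 *\<^sub>R v)" using M N by simp_all
  have "\<forall>\<^sub>F s in nhds 0. (g has_real_derivative g' s) (at s)"
    using twice_differentiable_along_line(1)[OF N0] twice_differentiable_along_line(1)[OF M0]
    unfolding g_def g'_def by eventually_elim (rule DERIV_diff)
  moreover have "(g' has_real_derivative dir_deriv2 N v (vec x0 + 0 *\<^sub>R v) - dir_deriv2 M v (vec x0 + 0 *\<^sub>R v)) (at 0)"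
    unfolding g'_def
    by (intro DERIV_diff twice_differentiable_along_line(3) M0 N0)
  moreover have "g' 0 = 0" by (simp add: g'_def dir_deriv_def eq)
  moreover have "\<forall>\<^sub>F s in nhds 0. g 0 \<le> g s"
    unfolding g_def by (rule locally_smaller_along_line[OF smaller])
  ultimately have "0 \<le> dir_deriv2 N v (vec x0 + 0 *\<^sub>R v) - dir_deriv2 M v (vec x0 + 0 *\<^sub>R v)"
    by (rule second_derivative_nonneg_at_local_min)
  moreover have "v $ i = 0" if "i \<notin> range \<iota>" for i using that by (simp add: v_def)
  ultimately show "0 \<le> w \<bullet> (second_deriv_diff_matrix \<iota> M N x0 *v w)"
    using dir_deriv2_diff_eq_quadratic_form[OF \<open>inj \<iota>\<close>, of v N "vec x0" M]
    by (simp add: w second_deriv_diff_matrix_def)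
qed

section \<open>Sufficient condition for local comparison\<close>

text \<open>The segment leading to \<open>x\<close> starts at \<open>vec (x $ k)\<close>, in general
  not at \<open>vec x0\<close>; hence the first-order equality is assumed at all diagonal points
  near \<open>vec x0\<close>.\<close>

lemma positive_definite_imp_locally_smaller:
  fixes M N :: "real ^ 'n \<Rightarrow> real" and \<iota> :: "'m::finite \<Rightarrow> 'n::finite"
  assumes mean: "is_mean I M" "is_mean I N"
    and \<iota>: "inj \<iota>" "range \<iota> = - {k}"
    and U: "open U" "x0 \<in> U" "U \<subseteq> I"
      "\<And>x i. x \<in> U \<Longrightarrow> partial_deriv i M (vec x) = partial_deriv i N (vec x)"
    and M: "twice_cont_differentiable_at_diag I M x0"
    and N: "twice_cont_differentiable_at_diag I N x0"
    and pd: "positive_definite (second_deriv_diff_matrix \<iota> M N x0)"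
  shows "locally_smaller I x0 M N"
proof -
  obtain V where V: "open V" "x0 \<in> V" "\<And>x. x \<in> cube V \<Longrightarrow> twice_differentiable_at M x"
    using M unfolding twice_cont_differentiable_at_diag_def by meson
  obtain W where W: "open W" "x0 \<in> W" "\<And>x. x \<in> cube W \<Longrightarrow> twice_differentiable_at N x"
    using N unfolding twice_cont_differentiable_at_diag_def by meson
  \<comment> \<open>\<open>B\<close> extends the given matrix off the diagonal, since the points of
    the segments need not be diagonal. It is continuous at \<open>vec x0\<close>, where it is the
    given matrix.\<close>
  define B where "B y = (\<chi> i j. partial_deriv (\<iota> i) (partial_deriv (\<iota> j) N) y -
            partial_deriv (\<iota> i) (partial_deriv (\<iota> j) M) y)" for y
  have "(B \<longlongrightarrow> B (vec x0)) (at (vec x0))"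
    using M N unfolding B_def twice_cont_differentiable_at_diag_def isCont_def
    by (intro tendsto_intros) auto
  then have "filterlim B (nhds (B (vec x0))) (nhds (vec x0))"
    by (simp add: tendsto_at_iff_tendsto_nhds)
  moreover have "\<forall>\<^sub>F A in nhds (B (vec x0)). positive_semidefinite A"
    using pd by (intro positive_definite_nhds) (simp add: B_def second_deriv_diff_matrix_def)
  ultimately have "\<forall>\<^sub>F y in nhds (vec x0). positive_semidefinite (B y)"
    by (rule eventually_compose_filterlim[rotated])
  moreover have "\<forall>\<^sub>F y in nhds (vec x0). y \<in> cube (U \<inter> V \<inter> W)"
    using U V W by (intro eventually_nhds_in_open open_cube) auto
  ultimately have "\<forall>\<^sub>F y in nhds (vec x0). positive_semidefinite (B y) \<and> y \<in> cube (U \<inter> V \<inter> W)"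
    by (rule eventually_conj)
  then obtain e where e: "e > 0"
      "\<And>y. dist y (vec x0) < e \<Longrightarrow> positive_semidefinite (B y) \<and> y \<in> cube (U \<inter> V \<inter> W)"
    by (auto simp: eventually_nhds_metric)
  \<comment> \<open>A cube must fit into the Euclidean ball of radius \<open>e\<close>: the distance
    is at most the sum of the \<open>CARD('n)\<close> coordinate distances, each below
    \<open>r\<close>.\<close>
  define r where "r = e / CARD('n)"
  have r: "r > 0" using e by (simp add: r_def)
  have near: "positive_semidefinite (B y) \<and> y \<in> cube (U \<inter> V \<inter> W)" if y: "y \<in> cube (ball x0 r)" for y
  proof (rule e(2))
    have "dist y (vec x0) \<le> (\<Sum>i\<in>UNIV. \<bar>(y - vec x0) $ i\<bar>)"
      unfolding dist_norm by (rule norm_le_l1_cart)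
    also have "\<dots> < (\<Sum>i\<in>(UNIV :: 'n set). r)"
      using y by (intro sum_strict_mono) (auto simp: cube_def dist_real_def abs_minus_commute)
    also have "\<dots> = e" by (simp add: r_def)
    finally show "dist y (vec x0) < e" .
  qed
  have "M x \<le> N x" if x: "x \<in> cube (ball x0 r)" for x
  proof -
    define p :: "real ^ 'n" where "p = vec (x $ k)"
    define v where "v = x - p"
    \<comment> \<open>Each coordinate of a point on the segment is a convex combination of
      \<open>x $ k\<close> and \<open>x $ i\<close>, both in the interval
      \<open>ball x0 r\<close>.\<close>
    have seg: "p + t *\<^sub>R v \<in> cube (ball x0 r)" if "0 \<le> t" "t \<le> 1" for t
    proof -
      have "(1 - t) *\<^sub>R (x $ k) + t *\<^sub>R (x $ i) \<in> ball x0 r" for i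
        using x that by (intro convexD[OF convex_ball]) (auto simp: cube_def)
      then show ?thesis by (simp add: cube_def p_def v_def algebra_simps)
    qed
    have xk: "x $ k \<in> U"
      using near[OF x] by (auto simp: cube_def)
    have v0: "v $ i = 0" if "i \<notin> range \<iota>" for i
      using that \<iota>(2) by (simp add: v_def p_def)
    have "0 \<le> N (p + 1 *\<^sub>R v) - M (p + 1 *\<^sub>R v)"
    proof (rule nonneg_by_second_derivative[where g = "\<lambda>t. N (p + t *\<^sub>R v) - M (p + t *\<^sub>R v)"])
      fix t :: real assume t: "0 \<le> t" "t \<le> 1"
      have td: "twice_differentiable_at M (p + t *\<^sub>R v)" "twice_differentiable_at N (p + t *\<^sub>R v)"
        using near[OF seg[OF t]] by (auto intro!: V W simp: cube_def)
      show "((\<lambda>t. N (p + t *\<^sub>R v) - M (p + t *\<^sub>R v)) has_real_derivative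
          dir_deriv N v (p + t *\<^sub>R v) - dir_deriv M v (p + t *\<^sub>R v)) (at t)"
        by (intro DERIV_diff twice_differentiable_along_line(2) td)
      show "((\<lambda>t. dir_deriv N v (p + t *\<^sub>R v) - dir_deriv M v (p + t *\<^sub>R v)) has_real_derivative
          dir_deriv2 N v (p + t *\<^sub>R v) - dir_deriv2 M v (p + t *\<^sub>R v)) (at t)"
        by (intro DERIV_diff twice_differentiable_along_line(3) td)
      show "0 \<le> dir_deriv2 N v (p + t *\<^sub>R v) - dir_deriv2 M v (p + t *\<^sub>R v)"
        using near[OF seg[OF t]] dir_deriv2_diff_eq_quadratic_form[OF \<iota>(1) v0]
        by (simp add: B_def positive_semidefinite_def)
    next
      show "N (p + 0 *\<^sub>R v) - M (p + 0 *\<^sub>R v) = 0"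
        using mean xk U(3) by (auto simp: p_def is_mean_vec)
      show "dir_deriv N v (p + 0 *\<^sub>R v) - dir_deriv M v (p + 0 *\<^sub>R v) = 0"
        using U(4)[OF xk] by (simp add: dir_deriv_def p_def)
    qed
    then show ?thesis by (simp add: v_def)
  qed
  \<comment> \<open>Applying \<open>near\<close> to diagonal points shows that the ball lies in
    \<open>U\<close>, hence in \<open>I\<close>.\<close>
  moreover have "ball x0 r \<subseteq> I"
  proof
    fix z assume "z \<in> ball x0 r"
    then have "(vec z :: real ^ 'n) \<in> cube (U \<inter> V \<inter> W)" using near[of "vec z"] by simp
    then show "z \<in> I" using U(3) by auto
  qed
  ultimately show ?thesis
    unfolding locally_smaller_def using r by (intro exI[of _ "ball x0 r"]) auto
qed

theorem theorem7:
  fixes I :: "real set" and x0 :: real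
    and M N :: "real ^ 'n \<Rightarrow> real"
    and \<iota> :: "'m::finite \<Rightarrow> 'n::finite"
  assumes "I \<noteq> {}" and "open I" and "is_interval I"
    and "CARD('n) \<ge> 2"
    and "inj \<iota>" and "CARD('m) = CARD('n) - 1"
    and "is_mean I M" and "is_mean I N"
    and "x0 \<in> I"
  shows
    "(locally_smaller I x0 M N \<and>
      partially_differentiable_at M (vec x0) \<and> partially_differentiable_at N (vec x0) \<longrightarrow>
        (\<forall>i. partial_deriv i M (vec x0) = partial_deriv i N (vec x0)) \<and>
        (twice_differentiable_at M (vec x0) \<and> twice_differentiable_at N (vec x0) \<longrightarrow>
          transpose (second_deriv_diff_matrix \<iota> M N x0) = second_deriv_diff_matrix \<iota> M N x0 \<and>
          positive_semidefinite (second_deriv_diff_matrix \<iota> M N x0)))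
     \<and>
     ((\<exists>U. open U \<and> x0 \<in> U \<and> U \<subseteq> I \<and>
         (\<forall>x \<in> U. \<forall>i. partial_deriv i M (vec x) = partial_deriv i N (vec x))) \<and>
      twice_cont_differentiable_at_diag I M x0 \<and> twice_cont_differentiable_at_diag I N x0 \<and>
      positive_definite (second_deriv_diff_matrix \<iota> M N x0) \<longrightarrow>
        locally_smaller I x0 M N)"
proof (intro conjI impI)
  assume A: "locally_smaller I x0 M N \<and>
      partially_differentiable_at M (vec x0) \<and> partially_differentiable_at N (vec x0)"
  then show eq: "\<forall>i. partial_deriv i M (vec x0) = partial_deriv i N (vec x0)"
    using locally_smaller_imp_partial_deriv_eq assms(7,8) by blast
  assume T: "twice_differentiable_at M (vec x0) \<and> twice_differentiable_at N (vec x0)"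
  then show "transpose (second_deriv_diff_matrix \<iota> M N x0) = second_deriv_diff_matrix \<iota> M N x0"
    by (simp add: second_deriv_diff_matrix_symmetric)
  show "positive_semidefinite (second_deriv_diff_matrix \<iota> M N x0)"
    using locally_smaller_imp_positive_semidefinite[OF assms(7,8) _ \<open>inj \<iota>\<close>] A T eq by blast
next
  assume A: "(\<exists>U. open U \<and> x0 \<in> U \<and> U \<subseteq> I \<and>
         (\<forall>x \<in> U. \<forall>i. partial_deriv i M (vec x) = partial_deriv i N (vec x))) \<and>
      twice_cont_differentiable_at_diag I M x0 \<and> twice_cont_differentiable_at_diag I N x0 \<and>
      positive_definite (second_deriv_diff_matrix \<iota> M N x0)"
  \<comment> \<open>Counting shows that exactly one index \<open>k\<close> is omitted; it takes the
    place of the last variable.\<close>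
  have "card (- range \<iota>) = 1"
    using assms(4-6) by (simp add: Compl_eq_Diff_UNIV card_Diff_subset card_image)
  then obtain k where "- range \<iota> = {k}" by (auto simp: card_1_singleton_iff)
  then have "range \<iota> = - {k}" by blast
  then show "locally_smaller I x0 M N"
    using A positive_definite_imp_locally_smaller[OF assms(7,8) \<open>inj \<iota>\<close>] by metis
qed

end
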